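(* Let $R=\begin{pmatrix}2&1\\0&2\end{pmatrix}$, $B=\left\{\begin{pmatrix}0\\0\end{pmatrix},\begin{pmatrix}1\\0\end{pmatrix}\right\}$, and let $\mu_{R,B}$ be the self-affine measure on $\mathbb{R}^2$ generated by $R$ and $B$. Then for every spectrum $\Lambda$ of $\mu_{R,B}$ one has $0\le \dim_{Be}(\Lambda)\le 1$. Moreover, both bounds are attained: there exist a spectrum of $\mu_{R,B}$ with Beurling dimension $0$ and a spectrum of $\mu_{R,B}$ with Beurling dimension $1$.
   Context: Self-affine measure: $\mu_{R,B}$ is the unique Borel probability measure on $\mathbb{R}^2$ satisfying $\mu(E)=\sum_{b\in B}\frac{1}{\#B}\,\mu(\varphi_b^{-1}(E))$ for all Borel sets $E\subseteq\mathbb{R}^2$, where $\varphi_b(x)=R^{-1}(x+b)$. Spectrum: a discrete set $\Lambda\subseteq\mathbb{R}^2$ is a spectrum of a Borel probability measure $\mu$ on $\mathbb{R}^2$ if $E(\Lambda)=\{e^{-2\pi i\langle\lambda,x\rangle}:\lambda\in\Lambda\}$ is an orthonormal basis of $L^2(\mu)$. Beurling density and dimension: for a discrete set $\Lambda\subseteq\mathbb{R}^2$ and $r>0$, the upper $r$-Beurling density is $D_r^+(\Lambda)=\limsup_{h\to\infty}\sup_{x\in\mathbb{R}^2}\frac{\#(\Lambda\cap B(x,h))}{h^r}$, where $B(x,h)$ is the open Euclidean ball with center $x$ and radius $h$. The Beurling dimension is $\dim_{Be}(\Lambda)=\inf\{r>0: D_r^+(\Lambda)=0\}=\sup\{r>0: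 D_r^+(\Lambda)=\infty\}$ (with the supremum of the empty set taken to be $0$). *)

theory Defs
  imports "HOL-Analysis.Analysis" "HOL-Probability.Probability_Measure"
begin

definition affine_contraction :: "real^2^2 \<Rightarrow> real^2 \<Rightarrow> real^2 \<Rightarrow> real^2" where
  "affine_contraction R b x = matrix_inv R *v (x + b)"

definition is_self_affine_measure :: "real^2^2 \<Rightarrow> (real^2) set \<Rightarrow> (real^2) measure \<Rightarrow> bool" where
  "is_self_affine_measure R B \<mu> \<longleftrightarrow>
     prob_space \<mu> \<and> sets \<mu> = sets borel \<and>
     (\<forall>E\<in>sets borel.
        measure \<mu> E = (\<Sum>b\<in>B. 1 / real (card B) * measure \<mu> (affine_contraction R b -` E)))"

(* The definite description denotes the intended measure only where there is exactly one,
   e.g. for R expansive and B finite and nonempty. *)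
definition self_affine_measure :: "real^2^2 \<Rightarrow> (real^2) set \<Rightarrow> (real^2) measure" where
  "self_affine_measure R B = (THE \<mu>. is_self_affine_measure R B \<mu>)"

(* L2_fun and L2_inner work with representatives, not with classes modulo null sets. *)
definition L2_fun :: "'a measure \<Rightarrow> ('a \<Rightarrow> complex) \<Rightarrow> bool" where
  "L2_fun \<mu> f \<longleftrightarrow> f \<in> borel_measurable \<mu> \<and> integrable \<mu> (\<lambda>x. (norm (f x))\<^sup>2)"

definition L2_inner :: "'a measure \<Rightarrow> ('a \<Rightarrow> complex) \<Rightarrow> ('a \<Rightarrow> complex) \<Rightarrow> complex" where
  "L2_inner \<mu> f g = (LINT x|\<mu>. f x * cnj (g x))"

(* An orthonormal family whose finite linear combinations are dense in L^2.
   It is indexed: members with different indices must be orthogonal, so they may not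
   coincide even almost everywhere. *)
definition orthonormal_basis_L2 ::
    "'a measure \<Rightarrow> ('i \<Rightarrow> 'a \<Rightarrow> complex) \<Rightarrow> 'i set \<Rightarrow> bool" where
  "orthonormal_basis_L2 \<mu> e I \<longleftrightarrow>
     (\<forall>i\<in>I. L2_fun \<mu> (e i)) \<and>
     (\<forall>i\<in>I. \<forall>j\<in>I. L2_inner \<mu> (e i) (e j) = (if i = j then 1 else 0)) \<and>
     (\<forall>f. L2_fun \<mu> f \<longrightarrow>
        (\<forall>\<epsilon>>0. \<exists>F c. finite F \<and> F \<subseteq> I \<and>
           (LINT x|\<mu>. (norm (f x - (\<Sum>i\<in>F. c i * e i x)))\<^sup>2) < \<epsilon>))"

definition expo :: "real^2 \<Rightarrow> real^2 \<Rightarrow> complex" where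
  "expo l x = exp (- 2 * of_real pi * \<i> * of_real (l \<bullet> x))"

definition is_spectrum :: "(real^2) measure \<Rightarrow> (real^2) set \<Rightarrow> bool" where
  "is_spectrum \<mu> \<Lambda> \<longleftrightarrow> discrete \<Lambda> \<and> orthonormal_basis_L2 \<mu> expo \<Lambda>"

(* Counting measure rather than card, so that an infinite intersection counts as infinity. *)
definition upper_beurling_density :: "real \<Rightarrow> (real^2) set \<Rightarrow> ennreal" where
  "upper_beurling_density r \<Lambda> =
     Limsup at_top (\<lambda>h::real.
       SUP x. emeasure (count_space UNIV) (\<Lambda> \<inter> ball x h) / ennreal (h powr r))"

(* Infimum in the extended reals: it is infinity when no density vanishes. *)
definition beurling_dim :: "(real^2) set \<Rightarrow> ereal" where
  "beurling_dim \<Lambda> = Inf {ereal r | r. r > 0 \<and> upper_beurling_density r \<Lambda> = 0}"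

lemma upper_beurling_density_eq_0:
  assumes "upper_beurling_density r \<Lambda> \<noteq> \<infinity>" "r < s"
  shows "upper_beurling_density s \<Lambda> = 0"
proof -
  define N where "N x h = emeasure (count_space UNIV) (\<Lambda> \<inter> ball x h)" for x and h :: real
  have "upper_beurling_density r \<Lambda> < top"
    using assms(1) by (simp add: top.not_eq_extremum)
  then obtain C where C: "upper_beurling_density r \<Lambda> < C" "C < top"
    using dense by blast
  have "\<forall>\<^sub>F h in at_top. (SUP x. N x h / ennreal (h powr r)) < C"
    using Limsup_lessD[OF C(1)[unfolded upper_beurling_density_def]] by (simp add: N_def)
  then have ev: "\<forall>\<^sub>F h in at_top.
      (SUP x. N x h / ennreal (h powr s)) \<le> C * ennreal (h powr (r - s))"
    using eventually_gt_at_top[of 0]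
  proof eventually_elim
    case (elim h)
    show ?case
    proof (rule SUP_least)
      fix x
      have le: "N x h / ennreal (h powr r) \<le> C"
        using elim(1) by (meson SUP_upper UNIV_I less_imp_le order_trans)
      have pos: "h powr s > 0" "h powr r > 0"
        using elim(2) by simp_all
      have "inverse (h powr s) = inverse (h powr r) * h powr (r - s)"
        using pos by (simp add: powr_diff divide_inverse)
      then have "inverse (ennreal (h powr s))
          = inverse (ennreal (h powr r)) * ennreal (h powr (r - s))"
        using pos by (simp only: inverse_ennreal) (simp add: ennreal_mult')
      then have "N x h / ennreal (h powr s)
          = N x h / ennreal (h powr r) * ennreal (h powr (r - s))"
        by (simp add: divide_ennreal_def mult.assoc)
      also have "\<dots> \<le> C * ennreal (h powr (r - s))"
        by (rule mult_right_mono[OF le]) simp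
      finally show "N x h / ennreal (h powr s) \<le> C * ennreal (h powr (r - s))" .
    qed
  qed
  have "((\<lambda>h::real. h powr (r - s)) \<longlongrightarrow> 0) at_top"
    using tendsto_neg_powr[of "r - s" "\<lambda>h. h" at_top] assms(2) by (simp add: filterlim_ident)
  then have "((\<lambda>h::real. C * ennreal (h powr (r - s))) \<longlongrightarrow> C * ennreal 0) at_top"
    using C(2) by (intro ennreal_tendsto_cmult tendsto_ennrealI)
  then have lim: "Limsup at_top (\<lambda>h::real. C * ennreal (h powr (r - s))) = 0"
    by (intro lim_imp_Limsup) auto
  have "upper_beurling_density s \<Lambda> \<le> Limsup at_top (\<lambda>h::real. C * ennreal (h powr (r - s)))"
    unfolding upper_beurling_density_def using ev by (intro Limsup_mono) (simp add: N_def)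
  then show ?thesis
    using lim by simp
qed

(* The 0 inserted here is the convention that the supremum of the empty set is 0. *)
lemma beurling_dim_eq_Sup:
  "beurling_dim \<Lambda> =
     Sup (insert 0 {ereal r | r. r > 0 \<and> upper_beurling_density r \<Lambda> = \<infinity>})"
    (is "_ = Sup ?S")
proof (rule antisym)
  show "beurling_dim \<Lambda> \<le> Sup ?S"
  proof (rule dense_ge)
    fix y assume y: "Sup ?S < y"
    then obtain t where t: "Sup ?S < ereal t" "ereal t < y"
      using ereal_dense2 by blast
    obtain s where s: "Sup ?S < ereal s" "ereal s < ereal t"
      using t(1) ereal_dense2 by blast
    have "0 \<le> Sup ?S"
      by (rule Sup_upper) simp
    then have "0 < ereal s"
      using s(1) by (rule order_le_less_trans)
    then have "0 < s"
      by simp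
    have "ereal s \<notin> ?S"
    proof
      assume "ereal s \<in> ?S"
      then have "ereal s \<le> Sup ?S"
        by (rule Sup_upper)
      then show False
        using s(1) leD by blast
    qed
    then have "upper_beurling_density s \<Lambda> \<noteq> \<infinity>"
      using \<open>0 < s\<close> by auto
    then have "upper_beurling_density t \<Lambda> = 0"
      using upper_beurling_density_eq_0 s(2) by auto
    then have "beurling_dim \<Lambda> \<le> ereal t"
      unfolding beurling_dim_def using \<open>0 < s\<close> s(2) by (intro Inf_lower) auto
    then show "beurling_dim \<Lambda> \<le> y"
      using t(2) by auto
  qed
next
  show "Sup ?S \<le> beurling_dim \<Lambda>"
    unfolding beurling_dim_def
  proof (intro Sup_least Inf_greatest)
    fix a b assume a: "a \<in> ?S"
      and "b \<in> {ereal r | r. r > 0 \<and> upper_beurling_density r \<Lambda> = 0}"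
    then obtain s where s: "b = ereal s" "s > 0" "upper_beurling_density s \<Lambda> = 0"
      by auto
    consider "a = 0" | r where "a = ereal r" "upper_beurling_density r \<Lambda> = \<infinity>"
      using a by auto
    then show "a \<le> b"
    proof cases
      case 1
      then show ?thesis using s by simp
    next
      case 2
      have "\<not> s < r"
        using upper_beurling_density_eq_0[of s \<Lambda> r] s(3) 2(2) by auto
      then show ?thesis using s 2 by simp
    qed
  qed
qed

end

theory Submission
  imports Defs "HOL-Probability.Distribution_Functions" "HOL-Real_Asymp.Real_Asymp"
begin

text \<open>
  Both maps send the first coordinate axis to itself and halve the second coordinate, so an invariant
  probability measure lives on that axis; there they act as \<open>t \<mapsto> t / 2\<close> and
  \<open>t \<mapsto> (t + 1) / 2\<close>, and the measure is Lebesgue measure on the segment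
  \<open>[0, 1) \<times> {0}\<close>. Hence exponentials see only the first coordinate of a frequency. In a spectrum
  the first coordinates differ by nonzero integers, so a ball of radius \<open>h\<close> contains \<open>O(h)\<close> points.
  Conversely, the second coordinates over the frequencies in \<open>\<int>\<close> are arbitrary: taking them all
  zero gives dimension 1, while letting them grow geometrically leaves only \<open>O(log h)\<close> points in a
  ball of radius \<open>h\<close> and gives dimension 0.
\<close>

section \<open>The self-affine measure\<close>

text \<open>\<open>self_affine_measure\<close> is a definite description, so the segment measure
  must be shown invariant and every invariant measure must be identified with it. For the latter,
  invariance becomes a functional equation for the distribution function of the first coordinate,
  which has only one solution. Integer gaps in a spectrum arise because the integral of
  \<open>cis (2 * pi * d * t)\<close> over [0, 1) vanishes exactly for nonzero integers
  \<open>d\<close>. The converse construction needs completeness of the trigonometric system: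
  Stone-Weierstrass on the circle covers continuous functions, a Dynkin argument passes to Borel
  sets, simple functions give all of L^2. A count of order h^r in balls of radius h bounds the
  dimension by r, and log h lies below every positive power of h.\<close>

text \<open>Monotonicity turns the mean into G(2t - 1) \<le> G(t) \<le> G(2t). Iterating the right
  half drives a negative t to minus infinity, and iterating the left half drives t > 1 away from the
  fixed point 1 to infinity; this gives the values 0 and 1 there. On [0, 1] the equation then halves
  the error G(t) - t.\<close>

lemma cdf_two_map_fixpoint:
  assumes "real_distribution N"
    and fe: "\<And>t. cdf N t = (cdf N (2 * t) + cdf N (2 * t - 1)) / 2"
  shows "cdf N t = max 0 (min 1 t)"
proof -
  interpret real_distribution N by fact
  define G where "G = cdf N"
  have fe: "G t = (G (2 * t) + G (2 * t - 1)) / 2" for t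
    using fe unfolding G_def .
  have mono: "x \<le> y \<Longrightarrow> G x \<le> G y" for x y
    unfolding G_def by (rule cdf_nondecreasing)
  have mono1: "G (x - 1) \<le> G x" for x
    by (rule mono) simp
  have nn: "0 \<le> G x" "G x \<le> 1" for x
    unfolding G_def by (auto simp: cdf_nonneg cdf_bounded_prob)
  have mean: "b \<le> a \<and> a \<le> c" if "a = (c + b) / 2" "b \<le> c" for a b c :: real
    using that by simp
  have double: "G s \<le> G (2 * s)" and double1: "G (2 * s - 1) \<le> G s" for s
    using mean[OF fe mono1] by auto
  have neg: "G t = 0" if "t < 0" for t
  proof -
    have le: "G t \<le> G (2 ^ n * t)" for n
    proof (induction n)
      case (Suc n)
      have "G (2 ^ n * t) \<le> G (2 * (2 ^ n * t))"
        by (rule double)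
      with Suc show ?case by (simp add: mult.assoc)
    qed simp
    have "filterlim (\<lambda>n. 2 ^ n * t) at_bot sequentially"
      using that by real_asymp
    then have "(\<lambda>n. G (2 ^ n * t)) \<longlonglongrightarrow> 0"
      unfolding G_def by (rule filterlim_compose[OF cdf_lim_at_bot])
    then have "G t \<le> 0"
      by (rule Lim_bounded2) (auto intro: le)
    then show ?thesis using nn[of t] by simp
  qed
  have gt1: "G t = 1" if "t > 1" for t
  proof -
    have le: "G t \<ge> G (1 + 2 ^ n * (t - 1))" for n
    proof (induction n)
      case (Suc n)
      let ?s = "1 + 2 ^ n * (t - 1)"
      have "G ?s \<ge> G (2 * ?s - 1)"
        by (rule double1)
      with Suc show ?case by (simp add: algebra_simps)
    qed simp
    have "filterlim (\<lambda>n. 1 + 2 ^ n * (t - 1)) at_top sequentially"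
      using that by real_asymp
    then have "(\<lambda>n. G (1 + 2 ^ n * (t - 1))) \<longlonglongrightarrow> 1"
      unfolding G_def by (rule filterlim_compose[OF cdf_lim_at_top_prob])
    then have "G t \<ge> 1"
      by (rule Lim_bounded) (auto intro: le)
    then show ?thesis using nn[of t] by simp
  qed
  have G0: "G 0 = 0" using fe[of 0] neg[of "-1"] by simp
  have G1: "G 1 = 1" using fe[of 1] gt1[of 2] by simp
  \<comment> \<open>One of the two terms is always known: G(2t - 1) = 0 for t < 1/2 and G(2t) = 1
    otherwise. The border case t = 1/2 is where the value at 1 is needed.\<close>
  have step: "\<bar>G t - t\<bar> \<le> (1 / 2) ^ n" if "0 \<le> t" "t \<le> 1" for n t
    using that
  proof (induction n arbitrary: t)
    case 0
    then show ?case using nn[of t] by auto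
  next
    case (Suc n)
    show ?case
    proof (cases "t < 1 / 2")
      case True
      then have "\<bar>G (2 * t) - 2 * t\<bar> \<le> (1 / 2) ^ n"
        using Suc by simp
      moreover have "2 * (G t - t) = G (2 * t) - 2 * t"
        using fe[of t] neg[of "2 * t - 1"] True by simp
      ultimately have "\<bar>2 * (G t - t)\<bar> \<le> (1 / 2) ^ n" by (simp only:)
      then show ?thesis unfolding abs_mult by simp
    next
      case False
      have "G (2 * t) = 1"
        using False gt1[of "2 * t"] G1 by (cases "2 * t = 1") auto
      moreover have "\<bar>G (2 * t - 1) - (2 * t - 1)\<bar> \<le> (1 / 2) ^ n"
        using Suc False by simp
      moreover have "2 * (G t - t) = G (2 * t - 1) - (2 * t - 1)"
        using fe[of t] calculation(1) by simp
      ultimately have "\<bar>2 * (G t - t)\<bar> \<le> (1 / 2) ^ n" by (simp only:)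
      then show ?thesis unfolding abs_mult by simp
    qed
  qed
  have mid: "G t = t" if "0 \<le> t" "t \<le> 1" for t
  proof -
    have "(\<lambda>n. (1 / 2 :: real) ^ n) \<longlonglongrightarrow> 0" by real_asymp
    then have "\<bar>G t - t\<bar> \<le> 0"
      by (rule Lim_bounded2) (use step[OF that] in auto)
    then show ?thesis by simp
  qed
  consider "t < 0" | "0 \<le> t" "t \<le> 1" | "t > 1" by linarith
  then have "G t = max 0 (min 1 t)"
    by cases (auto simp: neg mid gt1)
  then show ?thesis by (simp add: G_def)
qed

section \<open>The two contractions and uniqueness of the invariant measure\<close>

lemma affine_contraction_shear:
  fixes x b :: "real^2"
  defines "R \<equiv> vector [vector [2, 1], vector [0, 2]] :: real^2^2"
  shows "affine_contraction R b x = vector [(x $ 1 + b $ 1) / 2 - (x $ 2 + b $ 2) / 4, (x $ 2 + b $ 2) / 2]"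
proof -
  define A :: "real^2^2" where "A = vector [vector [1 / 2, - 1 / 4], vector [0, 1 / 2]]"
  have RA: "R ** A = mat 1" "A ** R = mat 1"
    by (auto simp: R_def A_def matrix_matrix_mult_def mat_def vec_eq_iff forall_2 sum_2 vector_2)
  have inv: "matrix_inv R = A"
    unfolding matrix_inv_def
  proof (rule some_equality)
    fix A' assume "R ** A' = mat 1 \<and> A' ** R = mat 1"
    then show "A' = A" using RA by (metis matrix_mul_assoc matrix_mul_lid matrix_mul_rid)
  qed (use RA in simp)
  show ?thesis
    unfolding affine_contraction_def inv
    by (simp add: A_def matrix_vector_mult_def vec_eq_iff forall_2 sum_2 vector_2 field_simps)
qed

text \<open>The contraction \<open>affine_contraction R b\<close> for b = (c, 0) with the inverse of
  R written out; c = 0 and c = 1 give the two maps of the system.\<close>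

definition shear_map :: "real \<Rightarrow> real^2 \<Rightarrow> real^2" where
  "shear_map c x = vector [(x $ 1 + c) / 2 - x $ 2 / 4, x $ 2 / 2]"

lemma shear_map_nth [simp]:
  "shear_map c x $ 1 = (x $ 1 + c) / 2 - x $ 2 / 4" "shear_map c x $ 2 = x $ 2 / 2"
  by (simp_all add: shear_map_def)

lemma continuous_on_vector_2 [continuous_intros]:
  fixes f g :: "'a::topological_space \<Rightarrow> real"
  assumes "continuous_on S f" "continuous_on S g"
  shows "continuous_on S (\<lambda>x. vector [f x, g x] :: real^2)"
proof -
  have *: "(vector [a, b] :: real^2) = (\<chi> i. if i = 1 then a else b)" for a b
    by (simp add: vec_eq_iff forall_2)
  have "continuous_on S (\<lambda>x. if i = 1 then f x else g x)" for i :: 2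
    using assms by (cases "i = 1") simp_all
  then show ?thesis
    unfolding * by (intro continuous_on_vec_lambda)
qed

lemma shear_map_measurable [measurable]: "shear_map c \<in> borel_measurable borel"
  unfolding shear_map_def
  by (auto intro!: borel_measurable_continuous_onI continuous_intros)

lemma vector_axis_measurable [measurable]:
  "(\<lambda>t. vector [t, 0] :: real^2) \<in> borel_measurable borel"
  by (intro borel_measurable_continuous_onI continuous_intros)

lemma is_self_affine_measure_shear_iff:
  "is_self_affine_measure (vector [vector [2, 1], vector [0, 2]]) {vector [0, 0], vector [1, 0]} \<mu> \<longleftrightarrow>
     prob_space \<mu> \<and> sets \<mu> = sets borel \<and>
     (\<forall>E\<in>sets borel. measure \<mu> E = (measure \<mu> (shear_map 0 -` E) + measure \<mu> (shear_map 1 -` E)) / 2)"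
proof -
  have ne: "(vector [0, 0] :: real^2) \<noteq> vector [1, 0]"
    by (simp add: vec_eq_iff forall_2)
  have "affine_contraction (vector [vector [2, 1], vector [0, 2]]) (vector [c, 0]) = shear_map c" for c
    by (intro ext) (simp add: affine_contraction_shear shear_map_def)
  then show ?thesis
    unfolding is_self_affine_measure_def using ne by (simp add: add_divide_distrib)
qed

text \<open>The strip of half-width a around the axis has the strip of half-width 2a as preimage
  under both maps, so the two have equal mass. Doubling forever exhausts the plane; hence every
  strip has mass 1, and so does their countable intersection.\<close>

lemma self_affine_measure_AE_axis:
  assumes "prob_space \<mu>" and [simp]: "sets \<mu> = sets borel"
    and inv: "\<And>E. E \<in> sets borel \<Longrightarrow> 
      measure \<mu> E = (measure \<mu> (shear_map 0 -` E) + measure \<mu> (shear_map 1 -` E)) / 2"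
  shows "AE x in \<mu>. x $ 2 = 0"
proof -
  interpret prob_space \<mu> by fact
  have [simp]: "space \<mu> = UNIV"
    using sets_eq_imp_space_eq[OF assms(2)] by simp
  define T where "T a = {x::real^2. \<bar>x $ 2\<bar> \<le> a}" for a
  have T[measurable]: "T a \<in> sets borel" for a
  proof -
    have "closed (T a)" unfolding T_def
      by (intro closed_Collect_le continuous_intros)
    then show ?thesis by simp
  qed
  have "measure \<mu> (T a) = measure \<mu> (T (2 * a))" for a
  proof -
    have "shear_map c -` T a = T (2 * a)" for c
      by (auto simp: T_def)
    then show ?thesis using inv[OF T, of a] by simp
  qed
  then have pow: "measure \<mu> (T a) = measure \<mu> (T (2 ^ n * a))" for a n
    by (induction n) (auto simp: mult.assoc)
  have one: "measure \<mu> (T a) = 1" if "a > 0" for a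
  proof -
    have "(\<lambda>n. measure \<mu> (T (2 ^ n * a))) \<longlonglongrightarrow> measure \<mu> (\<Union>n. T (2 ^ n * a))"
    proof (rule finite_Lim_measure_incseq)
      show "incseq (\<lambda>n. T (2 ^ n * a))"
      proof (rule incseq_SucI)
        fix n show "T (2 ^ n * a) \<le> T (2 ^ Suc n * a)"
          using that by (auto simp: T_def intro: order_trans)
      qed
    qed auto
    also have "(\<Union>n. T (2 ^ n * a)) = UNIV"
    proof -
      have "\<exists>n. \<bar>x $ 2\<bar> \<le> 2 ^ n * a" for x :: "real^2"
      proof -
        obtain n where "\<bar>x $ 2\<bar> / a < 2 ^ n"
          using real_arch_pow[of 2 "\<bar>x $ 2\<bar> / a"] by auto
        then show ?thesis using that by (auto simp: field_simps intro: less_imp_le)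
      qed
      then show ?thesis by (auto simp: T_def)
    qed
    also have "measure \<mu> UNIV = 1" using prob_space by simp
    finally have "(\<lambda>n::nat. measure \<mu> (T a)) \<longlonglongrightarrow> 1"
      using pow by simp
    then show ?thesis by (simp add: LIMSEQ_const_iff)
  qed
  have "AE x in \<mu>. x \<in> T (1 / real (Suc n))" for n
    using one by (intro prob_eq_1[THEN iffD1]) auto
  then have "AE x in \<mu>. \<forall>n. x \<in> T (1 / real (Suc n))"
    by (subst AE_all_countable) auto
  then show ?thesis
  proof eventually_elim
    case (elim x)
    show ?case
    proof (rule ccontr)
      assume "x $ 2 \<noteq> 0"
      then obtain n where "inverse (real (Suc n)) < \<bar>x $ 2\<bar>"
        using reals_Archimedean[of "\<bar>x $ 2\<bar>"] by auto
      then show False using elim by (auto simp: T_def inverse_eq_divide not_less[symmetric])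
    qed
  qed
qed

text \<open>An invariant measure is recovered from its first marginal because it is carried by the
  axis, and \<open>cdf_two_map_fixpoint\<close> determines that marginal.\<close>

lemma self_affine_measure_unique:
  assumes "prob_space \<mu>" "sets \<mu> = sets borel"
    and inv: "\<And>E. E \<in> sets borel \<Longrightarrow> 
      measure \<mu> E = (measure \<mu> (shear_map 0 -` E) + measure \<mu> (shear_map 1 -` E)) / 2"
    and "prob_space \<nu>" "sets \<nu> = sets borel"
    and inv': "\<And>E. E \<in> sets borel \<Longrightarrow> 
      measure \<nu> E = (measure \<nu> (shear_map 0 -` E) + measure \<nu> (shear_map 1 -` E)) / 2"
  shows "\<mu> = \<nu>"
proof -
  have cdf: "cdf (distr \<mu> borel (\<lambda>x. x $ 1)) t = max 0 (min 1 t)" 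
    and dist: "real_distribution (distr \<mu> borel (\<lambda>x. x $ 1))"
    and eq: "E \<in> sets borel \<Longrightarrow> 
       emeasure \<mu> E = emeasure (distr \<mu> borel (\<lambda>x. x $ 1)) ((\<lambda>t. vector [t, 0]) -` E)"
    if "prob_space \<mu>" and S [measurable_cong, simp]: "sets \<mu> = sets borel"
    and inv: "\<And>E. E \<in> sets borel \<Longrightarrow> 
      measure \<mu> E = (measure \<mu> (shear_map 0 -` E) + measure \<mu> (shear_map 1 -` E)) / 2"
    for \<mu> :: "(real^2) measure" and t E
  proof -
    interpret prob_space \<mu> by fact
    have [simp]: "space \<mu> = UNIV"
      using sets_eq_imp_space_eq[OF S] by simp
    have AE: "AE x in \<mu>. x $ 2 = 0"
      by (rule self_affine_measure_AE_axis) fact+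
    show dist: "real_distribution (distr \<mu> borel (\<lambda>x. x $ 1))"
      by (rule real_distribution_distr) simp
    have c: "cdf (distr \<mu> borel (\<lambda>x. x $ 1)) t = measure \<mu> {x. x $ 1 \<le> t}" for t
      by (simp add: cdf_def measure_distr vimage_def)
    have cl: "{x::real^2. x $ 1 \<le> t} \<in> sets borel" for t
    proof -
      have "{x::real^2. x $ 1 \<le> t} = (\<lambda>x. x $ 1) -` {..t} \<inter> space borel" by auto
      then show ?thesis by (simp only:) measurable
    qed
    \<comment> \<open>The sets agree only up to a null set: off the axis the shear contributes the
      term - x $ 2 / 4.\<close>
    have pre: "measure \<mu> (shear_map b -` {x. x $ 1 \<le> t}) = measure \<mu> {x. x $ 1 \<le> 2 * t - b}" for b t
    proof (rule finite_measure_eq_AE)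
      show "AE x in \<mu>. (x \<in> shear_map b -` {x. x $ 1 \<le> t}) = (x \<in> {x. x $ 1 \<le> 2 * t - b})"
        using AE by eventually_elim (auto simp: field_simps)
      show "shear_map b -` {x. x $ 1 \<le> t} \<in> sets \<mu>"
        using measurable_sets[OF shear_map_measurable cl] by simp
      show "{x. x $ 1 \<le> 2 * t - b} \<in> sets \<mu>" using cl by simp
    qed
    show "cdf (distr \<mu> borel (\<lambda>x. x $ 1)) t = max 0 (min 1 t)"
    proof (rule cdf_two_map_fixpoint[OF dist])
      fix t
      show "cdf (distr \<mu> borel (\<lambda>x. x $ 1)) t =
        (cdf (distr \<mu> borel (\<lambda>x. x $ 1)) (2 * t) + cdf (distr \<mu> borel (\<lambda>x. x $ 1)) (2 * t - 1)) / 2"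
        unfolding c by (subst inv[OF cl]) (simp only: pre, simp)
    qed
    assume E[measurable]: "E \<in> sets borel"
    have p: "(\<lambda>t. vector [t, 0] :: real^2) -` E \<in> sets borel"
      using measurable_sets[OF vector_axis_measurable E] by simp
    have q: "{x. vector [x $ 1, 0] \<in> E} \<in> sets \<mu>"
      using measurable_sets[OF _ p, of "\<lambda>x. x $ 1" borel] by (simp add: vimage_def)
    have "emeasure (distr \<mu> borel (\<lambda>x. x $ 1)) ((\<lambda>t. vector [t, 0]) -` E) 
       = emeasure \<mu> {x. vector [x $ 1, 0] \<in> E}"
      using p by (subst emeasure_distr) (auto simp: vimage_def)
    \<comment> \<open>Projecting to the axis fixes almost every point, so it does not change the
      mass of \<open>E\<close>.\<close>
    also have "\<dots> = emeasure \<mu> E"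
    proof (rule emeasure_eq_AE)
      show "AE x in \<mu>. (x \<in> {x. vector [x $ 1, 0] \<in> E}) = (x \<in> E)"
        using AE
      proof eventually_elim
        case (elim x)
        then have "vector [x $ 1, 0] = x" by (simp add: vec_eq_iff forall_2)
        then show ?case by simp
      qed
    qed (use q in auto)
    finally show "emeasure \<mu> E = emeasure (distr \<mu> borel (\<lambda>x. x $ 1)) ((\<lambda>t. vector [t, 0]) -` E)" ..
  qed
  have "distr \<mu> borel (\<lambda>x. x $ 1) = distr \<nu> borel (\<lambda>x. x $ 1)"
    using cdf[OF assms(1-3)] cdf[OF assms(4-6)] dist[OF assms(1-3)] dist[OF assms(4-6)]
    by (intro cdf_unique) auto
  then show ?thesis
    using eq[OF assms(1-3)] eq[OF assms(4-6)] assms(2,5)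
    by (intro measure_eqI) auto
qed

section \<open>Invariance of Lebesgue measure on the segment\<close>

text \<open>With a half-open interval the two halves are disjoint and cover it without exceptional
  points, and \<open>cis (2 * pi * t)\<close> is injective on it.\<close>

definition unit_lebesgue :: "real measure" where
  "unit_lebesgue = density lborel (indicator {0..<1})"

lemma sets_unit_lebesgue [simp, measurable_cong]: "sets unit_lebesgue = sets borel"
  and space_unit_lebesgue [simp]: "space unit_lebesgue = UNIV"
  by (simp_all add: unit_lebesgue_def)

lemma prob_space_unit_lebesgue: "prob_space unit_lebesgue"
  by (rule prob_spaceI) (simp add: unit_lebesgue_def emeasure_density)

definition segment_measure :: "(real^2) measure" where
  "segment_measure = distr unit_lebesgue borel (\<lambda>t. vector [t, 0])"

lemma prob_space_segment_measure: "prob_space segment_measure"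
  unfolding segment_measure_def
  by (rule prob_space.prob_space_distr[OF prob_space_unit_lebesgue]) simp

lemma sets_segment_measure [simp, measurable_cong]: "sets segment_measure = sets borel"
  by (simp add: segment_measure_def)

lemma measurable_segment_measure [simp]: "borel_measurable segment_measure = borel_measurable borel"
  by (intro measurable_cong_sets) simp_all

text \<open>The substitution x = (t + c) / 2 has Jacobian 1/2 and carries [0, 1) onto [c/2, (c +
  1)/2); c = 0 and c = 1 yield the two halves of [0, 1).\<close>

lemma unit_lebesgue_halves:
  assumes [measurable]: "A \<in> sets borel"
  shows "emeasure unit_lebesgue A =
    (emeasure unit_lebesgue {t. t / 2 \<in> A} + emeasure unit_lebesgue {t. (t + 1) / 2 \<in> A}) / 2"
proof -
  have *: "emeasure unit_lebesgue {t. (t + c) / 2 \<in> A} / 2 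
    = (\<integral>\<^sup>+x. indicator A x * indicator {c/2..<(c+1)/2} x \<partial>lborel)" for c
  proof -
    have [measurable]: "{t. (t + c) / 2 \<in> A} \<in> sets borel"
      using measurable_sets[OF _ assms, of "\<lambda>t. (t + c) / 2" borel] by (simp add: vimage_def)
    have "(\<integral>\<^sup>+x. indicator A x * indicator {c/2..<(c+1)/2} x \<partial>lborel)
      = ennreal \<bar>1/2\<bar> * (\<integral>\<^sup>+x. indicator A (c / 2 + 1 / 2 * x) * indicator {c/2..<(c+1)/2} (c / 2 + 1 / 2 * x) \<partial>lborel)"
      by (rule nn_integral_real_affine) auto
    also have "(\<integral>\<^sup>+x. indicator A (c / 2 + 1 / 2 * x) * indicator {c/2..<(c+1)/2} (c / 2 + 1 / 2 * x) \<partial>lborel)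
       = (\<integral>\<^sup>+x. indicator {0..<1} x * indicator {t. (t + c) / 2 \<in> A} x \<partial>lborel)"
      by (intro nn_integral_cong) (auto simp: indicator_def field_simps)
    also have "\<dots> = emeasure unit_lebesgue {t. (t + c) / 2 \<in> A}"
      by (simp add: unit_lebesgue_def emeasure_density)
    finally show ?thesis
      by (simp add: divide_ennreal_def mult.commute ennreal_divide_numeral[symmetric] 
           flip: ennreal_inverse_1 inverse_ennreal)
  qed
  have "emeasure unit_lebesgue A = (\<integral>\<^sup>+x. indicator {0..<1} x * indicator A x \<partial>lborel)"
    by (simp add: unit_lebesgue_def emeasure_density)
  also have "\<dots> = (\<integral>\<^sup>+x. indicator A x * indicator {0/2..<(0+1)/2} x + indicator A x * indicator {1/2..<(1+1)/2} x \<partial>lborel)"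
    by (intro nn_integral_cong) (auto simp: indicator_def)
  also have "\<dots> = (\<integral>\<^sup>+x. indicator A x * indicator {0/2..<(0+1)/2} x \<partial>lborel) + 
     (\<integral>\<^sup>+x. indicator A x * indicator {1/2..<(1+1)/2} x \<partial>lborel)"
    by (rule nn_integral_add) auto
  also have "\<dots> = (emeasure unit_lebesgue {t. t / 2 \<in> A} + emeasure unit_lebesgue {t. (t + 1) / 2 \<in> A}) / 2"
    using *[of 0] *[of 1] by (simp add: add_divide_distrib_ennreal)
  finally show ?thesis .
qed

lemma measure_segment_measure:
  assumes "E \<in> sets borel"
  shows "measure segment_measure E = measure unit_lebesgue {t. vector [t, 0] \<in> E}"
  using assms by (simp add: segment_measure_def measure_distr vimage_def)

lemma self_affine_measure_shear:
  "self_affine_measure (vector [vector [2, 1], vector [0, 2]]) {vector [0, 0], vector [1, 0]} = segment_measure"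
proof -
  interpret prob_space unit_lebesgue by (rule prob_space_unit_lebesgue)
  have inv: "measure segment_measure E = 
     (measure segment_measure (shear_map 0 -` E) + measure segment_measure (shear_map 1 -` E)) / 2"
    if E: "E \<in> sets borel" for E
  proof -
    define A where "A = {t. vector [t, 0] \<in> E}"
    have A: "A \<in> sets borel"
      using measurable_sets[OF vector_axis_measurable E] by (simp add: A_def vimage_def)
    have "measure segment_measure (shear_map c -` E) = measure unit_lebesgue {t. (t + c) / 2 \<in> A}" for c
    proof -
      have "shear_map c -` E \<in> sets borel"
        using measurable_sets[OF shear_map_measurable E] by simp
      then show ?thesis
        by (simp add: measure_segment_measure A_def shear_map_def)
    qed
    moreover have "measure unit_lebesgue A = 
       (measure unit_lebesgue {t. (t + 0) / 2 \<in> A} + measure unit_lebesgue {t. (t + 1) / 2 \<in> A}) / 2"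
    proof -
      have "ennreal (measure unit_lebesgue A) = ennreal 
       ((measure unit_lebesgue {t. (t + 0) / 2 \<in> A} + measure unit_lebesgue {t. (t + 1) / 2 \<in> A}) / 2)"
        using unit_lebesgue_halves[OF A]
        by (simp add: emeasure_eq_measure flip: ennreal_plus ennreal_divide_numeral)
      then show ?thesis by (subst (asm) ennreal_inj) auto
    qed
    ultimately show ?thesis
      using E by (simp add: measure_segment_measure A_def)
  qed
  show ?thesis
    unfolding self_affine_measure_def
  proof (rule the_equality)
    show "is_self_affine_measure (vector [vector [2, 1], vector [0, 2]]) {vector [0, 0], vector [1, 0]} segment_measure"
      unfolding is_self_affine_measure_shear_iff
      using inv prob_space_segment_measure by auto
    fix \<mu> :: "(real^2) measure"
    assume "is_self_affine_measure (vector [vector [2, 1], vector [0, 2]]) {vector [0, 0], vector [1, 0]} \<mu>"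
    then show "\<mu> = segment_measure"
      unfolding is_self_affine_measure_shear_iff
      using inv prob_space_segment_measure by (intro self_affine_measure_unique) auto
  qed
qed

section \<open>Completeness of the trigonometric system\<close>

lemma measurable_unit_lebesgue [simp]: "borel_measurable unit_lebesgue = borel_measurable borel"
  by (intro measurable_cong_sets) simp_all

text \<open>The bound |a + b|^2 \<le> 2 |a|^2 + 2 |b|^2 replaces Minkowski's inequality and avoids
  square roots of integrals. Its factor 2 is why two errors below \<open>\<epsilon> / 4\<close> are
  requested later.\<close>

lemma L2_fun_add:
  assumes f: "L2_fun M f" and g: "L2_fun M g"
  shows "L2_fun M (\<lambda>x. f x + g x)"
    and "(LINT x|M. (norm (f x + g x))\<^sup>2) \<le> 2 * (LINT x|M. (norm (f x))\<^sup>2) + 2 * (LINT x|M. (norm (g x))\<^sup>2)"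
proof -
  have [measurable]: "f \<in> borel_measurable M" "g \<in> borel_measurable M"
    and i: "integrable M (\<lambda>x. (norm (f x))\<^sup>2)" "integrable M (\<lambda>x. (norm (g x))\<^sup>2)"
    using f g by (auto simp: L2_fun_def)
  have le: "(norm (f x + g x))\<^sup>2 \<le> 2 * (norm (f x))\<^sup>2 + 2 * (norm (g x))\<^sup>2" for x
  proof -
    have "(norm (f x + g x))\<^sup>2 \<le> (norm (f x) + norm (g x))\<^sup>2"
      by (intro power_mono norm_triangle_ineq) auto
    also have "\<dots> \<le> 2 * (norm (f x))\<^sup>2 + 2 * (norm (g x))\<^sup>2"
      using sum_squares_bound[of "norm (f x)" "norm (g x)"] by (simp add: power2_sum)
    finally show ?thesis .
  qed
  have int: "integrable M (\<lambda>x. 2 * (norm (f x))\<^sup>2 + 2 * (norm (g x))\<^sup>2)"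
    using i by auto
  have int': "integrable M (\<lambda>x. (norm (f x + g x))\<^sup>2)"
    by (rule Bochner_Integration.integrable_bound[OF int]) (use le in auto)
  then show "L2_fun M (\<lambda>x. f x + g x)"
    by (simp add: L2_fun_def)
  have "(LINT x|M. (norm (f x + g x))\<^sup>2) \<le> (LINT x|M. 2 * (norm (f x))\<^sup>2 + 2 * (norm (g x))\<^sup>2)"
    by (rule integral_mono[OF int' int]) (rule le)
  then show "(LINT x|M. (norm (f x + g x))\<^sup>2) \<le> 2 * (LINT x|M. (norm (f x))\<^sup>2) + 2 * (LINT x|M. (norm (g x))\<^sup>2)"
    using i by simp
qed

lemma L2_fun_cmult: "L2_fun M f \<Longrightarrow> L2_fun M (\<lambda>x. c * f x)"
  by (auto simp: L2_fun_def norm_mult power_mult_distrib)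

lemma L2_fun_diff: "L2_fun M f \<Longrightarrow> L2_fun M g \<Longrightarrow> L2_fun M (\<lambda>x. f x - g x)"
  using L2_fun_add(1)[of M f "\<lambda>x. (-1) * g x"] L2_fun_cmult[of M g "-1"] by simp

lemma (in finite_measure) L2_fun_bounded:
  assumes "f \<in> borel_measurable M" "\<And>x. norm (f x) \<le> C"
  shows "L2_fun M f"
  unfolding L2_fun_def
proof (intro conjI integrable_const_bound)
  have "(norm (f x))\<^sup>2 \<le> C\<^sup>2" for x
    using assms(2) by (intro power_mono) auto
  then show "AE x in M. norm ((norm (f x))\<^sup>2) \<le> C\<^sup>2" by simp
qed (use assms in auto)

section \<open>Trigonometric polynomials\<close>

text \<open>The inductive form lets frequencies repeat, so sums are immediate and products follow by
  a double induction; coefficients are collected only in \<open>trig_poly_imp_sum\<close>.\<close>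

inductive trig_poly :: "(real \<Rightarrow> complex) \<Rightarrow> bool" where
  monom: "trig_poly (\<lambda>t. c * cis (2 * pi * of_int n * t))"
| add: "trig_poly p \<Longrightarrow> trig_poly q \<Longrightarrow> trig_poly (\<lambda>t. p t + q t)"

lemma trig_poly_const: "trig_poly (\<lambda>_. c)"
  using trig_poly.monom[of c 0] by simp

lemma trig_poly_mult:
  assumes "trig_poly p" "trig_poly q"
  shows "trig_poly (\<lambda>t. p t * q t)"
  using assms(1)
proof induction
  case (monom c n)
  show ?case
    using assms(2)
  proof induction
    case (monom d m)
    have "cis (2 * pi * of_int (n + m) * t) = cis (2 * pi * of_int n * t) * cis (2 * pi * of_int m * t)" for t
      by (simp add: cis_mult distrib_left distrib_right)
    then have "(\<lambda>t. c * cis (2 * pi * of_int n * t) * (d * cis (2 * pi * of_int m * t))) =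
      (\<lambda>t. (c * d) * cis (2 * pi * of_int (n + m) * t))"
      by (simp add: mult_ac)
    then show ?case by (metis trig_poly.monom)
  next
    case (add p q)
    then show ?case using trig_poly.add by (simp add: distrib_left)
  qed
next
  case (add p q)
  then show ?case using trig_poly.add by (simp add: distrib_right)
qed

lemma trig_poly_cmult: "trig_poly p \<Longrightarrow> trig_poly (\<lambda>t. c * p t)"
  by (rule trig_poly_mult[OF trig_poly_const])

lemma trig_poly_measurable [measurable_dest]: "trig_poly p \<Longrightarrow> p \<in> borel_measurable borel"
  by (induction rule: trig_poly.induct)
    (auto intro!: borel_measurable_continuous_onI continuous_intros)

lemma trig_poly_L2: 
  assumes "trig_poly p" 
  shows "L2_fun unit_lebesgue p"
proof -
  interpret prob_space unit_lebesgue by (rule prob_space_unit_lebesgue)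
  show ?thesis using assms
  proof induction
    case (monom c n)
    have "trig_poly (\<lambda>t. c * cis (2 * pi * of_int n * t))" by (rule trig_poly.monom)
    then show ?case by (intro L2_fun_bounded[where C = "norm c"]) (auto simp: norm_mult dest: trig_poly_measurable)
  qed (rule L2_fun_add)
qed

text \<open>Real polynomial functions on the plane are generated by constants and linear
  functionals. On the circle a linear functional is f(1) cos + f(i) sin, which Euler's formulas
  write with the frequencies 1 and -1.\<close>

lemma trig_poly_real_polynomial_function:
  assumes "real_polynomial_function p"
  shows "trig_poly (\<lambda>t. of_real (p (cis (2 * pi * t))))"
  using assms
proof induction
  case (linear f)
  have "of_real (f (cis (2 * pi * t))) =
     (f 1 / 2 + f \<i> / (2 * \<i>)) * cis (2 * pi * of_int 1 * t) + 
     (f 1 / 2 - f \<i> / (2 * \<i>)) * cis (2 * pi * of_int (-1) * t)" (is "_ = ?r t") for t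
  proof -
    have "cis (2 * pi * t) = cos (2 * pi * t) *\<^sub>R 1 + sin (2 * pi * t) *\<^sub>R \<i>"
      by (simp add: complex_eq_iff)
    then have "f (cis (2 * pi * t)) = cos (2 * pi * t) * f 1 + sin (2 * pi * t) * f \<i>"
      using linear by (simp add: linear_simps bounded_linear.linear)
    then show ?thesis
      by (simp add: complex_eq_iff field_simps)
  qed
  moreover have "trig_poly ?r"
    by (intro trig_poly.intros)
  ultimately show ?case by simp
qed (auto intro: trig_poly_const trig_poly.add trig_poly_mult)

section \<open>The L^2 closure of the trigonometric polynomials\<close>

definition trig_approx :: "(real \<Rightarrow> complex) \<Rightarrow> bool" where
  "trig_approx f \<longleftrightarrow> L2_fun unit_lebesgue f \<and>
     (\<forall>\<epsilon>>0. \<exists>p. trig_poly p \<and> (LINT t|unit_lebesgue. (norm (f t - p t))\<^sup>2) < \<epsilon>)"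

lemma trig_approx_trig_poly: "trig_poly p \<Longrightarrow> trig_approx p"
  unfolding trig_approx_def using trig_poly_L2 by force

lemma trig_approx_closed:
  assumes "L2_fun unit_lebesgue f"
    and "\<And>\<epsilon>. \<epsilon> > 0 \<Longrightarrow> \<exists>g. trig_approx g \<and> (LINT t|unit_lebesgue. (norm (f t - g t))\<^sup>2) < \<epsilon>"
  shows "trig_approx f"
  unfolding trig_approx_def
proof (intro conjI allI impI)
  fix \<epsilon> :: real assume "\<epsilon> > 0"
  then obtain g where g: "trig_approx g" "(LINT t|unit_lebesgue. (norm (f t - g t))\<^sup>2) < \<epsilon> / 4"
    using assms(2)[of "\<epsilon> / 4"] by auto
  with \<open>\<epsilon> > 0\<close> obtain p where p: "trig_poly p" "(LINT t|unit_lebesgue. (norm (g t - p t))\<^sup>2) < \<epsilon> / 4"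
    unfolding trig_approx_def by (meson divide_pos_pos zero_less_numeral)
  have "(LINT t|unit_lebesgue. (norm ((f t - g t) + (g t - p t)))\<^sup>2) \<le> 
     2 * (LINT t|unit_lebesgue. (norm (f t - g t))\<^sup>2) + 2 * (LINT t|unit_lebesgue. (norm (g t - p t))\<^sup>2)"
    using g(1) trig_poly_L2[OF p(1)] assms(1)
    by (intro L2_fun_add(2) L2_fun_diff) (simp_all add: trig_approx_def)
  then have "(LINT t|unit_lebesgue. (norm (f t - p t))\<^sup>2) < \<epsilon>"
    using g(2) p(2) by simp
  then show "\<exists>p. trig_poly p \<and> (LINT t|unit_lebesgue. (norm (f t - p t))\<^sup>2) < \<epsilon>"
    using p(1) by blast
qed (rule assms(1))

lemma trig_approx_add:
  assumes "trig_approx f" "trig_approx g"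
  shows "trig_approx (\<lambda>t. f t + g t)"
  unfolding trig_approx_def
proof (intro conjI allI impI)
  show "L2_fun unit_lebesgue (\<lambda>t. f t + g t)"
    using assms by (simp add: trig_approx_def L2_fun_add)
  fix \<epsilon> :: real assume "\<epsilon> > 0"
  then have "\<epsilon> / 4 > 0" by simp
  with assms obtain p q where p: "trig_poly p" "(LINT t|unit_lebesgue. (norm (f t - p t))\<^sup>2) < \<epsilon> / 4"
    and q: "trig_poly q" "(LINT t|unit_lebesgue. (norm (g t - q t))\<^sup>2) < \<epsilon> / 4"
    unfolding trig_approx_def by meson
  have "(LINT t|unit_lebesgue. (norm ((f t - p t) + (g t - q t)))\<^sup>2) \<le> 
     2 * (LINT t|unit_lebesgue. (norm (f t - p t))\<^sup>2) + 2 * (LINT t|unit_lebesgue. (norm (g t - q t))\<^sup>2)"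
    using trig_poly_L2[OF p(1)] trig_poly_L2[OF q(1)] assms
    by (intro L2_fun_add(2) L2_fun_diff) (simp_all add: trig_approx_def)
  then have "(LINT t|unit_lebesgue. (norm ((f t + g t) - (p t + q t)))\<^sup>2) < \<epsilon>"
    using p(2) q(2) by (simp add: add_diff_add)
  then show "\<exists>r. trig_poly r \<and> (LINT t|unit_lebesgue. (norm (f t + g t - r t))\<^sup>2) < \<epsilon>"
    using trig_poly.add[OF p(1) q(1)] by blast
qed

lemma trig_approx_cmult:
  assumes "trig_approx f"
  shows "trig_approx (\<lambda>t. c * f t)"
proof (cases "c = 0")
  case True
  then show ?thesis by (simp add: trig_approx_trig_poly trig_poly_const)
next
  case False
  show ?thesis
    unfolding trig_approx_def
  proof (intro conjI allI impI)
    show "L2_fun unit_lebesgue (\<lambda>t. c * f t)"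
      using assms by (simp add: trig_approx_def L2_fun_cmult)
    fix \<epsilon> :: real assume "\<epsilon> > 0"
    then have "\<epsilon> / (norm c)\<^sup>2 > 0" using False by simp
    with assms obtain p where p: "trig_poly p" "(LINT t|unit_lebesgue. (norm (f t - p t))\<^sup>2) < \<epsilon> / (norm c)\<^sup>2"
      unfolding trig_approx_def by meson
    have "(LINT t|unit_lebesgue. (norm (c * f t - c * p t))\<^sup>2) = 
      (norm c)\<^sup>2 * (LINT t|unit_lebesgue. (norm (f t - p t))\<^sup>2)"
      by (simp add: norm_mult power_mult_distrib flip: right_diff_distrib)
    also have "\<dots> < \<epsilon>"
      using p(2) False by (simp add: field_simps)
    finally show "\<exists>r. trig_poly r \<and> (LINT t|unit_lebesgue. (norm (c * f t - r t))\<^sup>2) < \<epsilon>"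
      using trig_poly_cmult[OF p(1)] by blast
  qed
qed

lemma trig_approx_sum:
  assumes "finite I" "\<And>i. i \<in> I \<Longrightarrow> trig_approx (p i)"
  shows "trig_approx (\<lambda>t. \<Sum>i\<in>I. p i t)"
  using assms
proof (induction I)
  case empty
  then show ?case by (simp add: trig_approx_trig_poly trig_poly_const)
next
  case (insert i I)
  then show ?case by (simp add: trig_approx_add)
qed

text \<open>Since |f - s n|^2 \<le> (2 w)^2, dominated convergence upgrades pointwise to L^2
  convergence. Each enlargement of the class, from polynomials to continuous functions, indicators
  and finally all of L^2, passes through this lemma.\<close>

lemma trig_approx_dominated:
  fixes f :: "real \<Rightarrow> complex" and w :: "real \<Rightarrow> real"
  assumes s: "\<And>n. trig_approx (s n)"
    and [measurable]: "f \<in> borel_measurable borel"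
    and w: "integrable unit_lebesgue (\<lambda>t. (w t)\<^sup>2)"
    and lim: "\<And>t. (\<lambda>n. s n t) \<longlonglongrightarrow> f t"
    and bound: "\<And>n t. norm (s n t) \<le> w t"
  shows "trig_approx f"
proof -
  have [measurable]: "s n \<in> borel_measurable borel" for n
    using s[of n] by (simp add: trig_approx_def L2_fun_def)
  have fw: "norm (f t) \<le> w t" for t
    by (rule Lim_bounded[OF tendsto_norm[OF lim]]) (use bound in auto)
  have L2f: "L2_fun unit_lebesgue f"
    unfolding L2_fun_def
  proof
    show "integrable unit_lebesgue (\<lambda>x. (norm (f x))\<^sup>2)"
      by (rule Bochner_Integration.integrable_bound[OF w]) (use fw in \<open>auto intro!: AE_I2 power_mono\<close>)
  qed simp
  have "(\<lambda>n. LINT t|unit_lebesgue. (norm (f t - s n t))\<^sup>2) \<longlonglongrightarrow> (LINT t|unit_lebesgue. 0)"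
  proof (rule integral_dominated_convergence[where w = "\<lambda>t. 4 * (w t)\<^sup>2"])
    show "integrable unit_lebesgue (\<lambda>t. 4 * (w t)\<^sup>2)" using w by simp
    have "(\<lambda>n. (norm (f t - s n t))\<^sup>2) \<longlonglongrightarrow> (norm (f t - f t))\<^sup>2" for t
      by (intro tendsto_intros lim)
    then show "AE t in unit_lebesgue. (\<lambda>n. (norm (f t - s n t))\<^sup>2) \<longlonglongrightarrow> 0" by simp
    have "(norm (f t - s n t))\<^sup>2 \<le> (2 * w t)\<^sup>2" for n t
      using norm_triangle_ineq4[of "f t" "s n t"] fw[of t] bound[of n t]
      by (intro power_mono) auto
    then show "AE t in unit_lebesgue. norm ((norm (f t - s n t))\<^sup>2) \<le> 4 * (w t)\<^sup>2" for n
      by (simp add: power_mult_distrib)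
  qed simp_all
  then have lim0: "(\<lambda>n. LINT t|unit_lebesgue. (norm (f t - s n t))\<^sup>2) \<longlonglongrightarrow> 0" by simp
  show ?thesis
  proof (rule trig_approx_closed[OF L2f])
    fix \<epsilon> :: real assume "\<epsilon> > 0"
    then have "\<forall>\<^sub>F n in sequentially. (LINT t|unit_lebesgue. (norm (f t - s n t))\<^sup>2) < \<epsilon>"
      using lim0 by (rule order_tendstoD(2)[rotated])
    then obtain n where "(LINT t|unit_lebesgue. (norm (f t - s n t))\<^sup>2) < \<epsilon>"
      by (meson eventually_sequentially order_refl)
    then show "\<exists>g. trig_approx g \<and> (LINT t|unit_lebesgue. (norm (f t - g t))\<^sup>2) < \<epsilon>"
      using s by blast
  qed
qed

lemma integrable_unit_lebesgue_const [simp]: "integrable unit_lebesgue (\<lambda>_. c :: real)"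
  using finite_measure.integrable_const[OF prob_space.finite_measure[OF prob_space_unit_lebesgue]] .

text \<open>Working on the circle builds periodicity in, so Stone-Weierstrass applies on a compact
  set. Uniform errors below 1 / (n + 1) give the constant majorant C + 1.\<close>

lemma trig_approx_continuous_circle:
  fixes g :: "complex \<Rightarrow> real"
  assumes g: "continuous_on (sphere 0 1) g"
  shows "trig_approx (\<lambda>t. of_real (g (cis (2 * pi * t))))"
proof -
  interpret prob_space unit_lebesgue by (rule prob_space_unit_lebesgue)
  have [measurable]: "(\<lambda>t. g (cis (2 * pi * t))) \<in> borel_measurable borel"
    by (intro borel_measurable_continuous_onI continuous_on_compose2[OF g] continuous_intros) auto
  have "\<exists>q. real_polynomial_function q \<and> (\<forall>x\<in>sphere 0 1. \<bar>g x - q x\<bar> < 1 / real (Suc n))" for n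
    using Stone_Weierstrass_real_polynomial_function[OF compact_sphere g, of "1 / real (Suc n)"] 
    by (metis of_nat_0_less_iff zero_less_Suc zero_less_divide_1_iff)
  then obtain q where q: "\<And>n. real_polynomial_function (q n)"
    "\<And>n x. x \<in> sphere 0 1 \<Longrightarrow> \<bar>g x - q n x\<bar> < 1 / real (Suc n)"
    by metis
  obtain C where C: "\<And>x. x \<in> sphere 0 1 \<Longrightarrow> \<bar>g x\<bar> \<le> C"
    using compact_imp_bounded[OF compact_continuous_image[OF g compact_sphere]]
    unfolding bounded_iff by (metis image_eqI real_norm_def)
  have cs: "cis x \<in> sphere 0 1" for x by simp
  show ?thesis
  proof (rule trig_approx_dominated)
    show "trig_approx (\<lambda>t. of_real (q n (cis (2 * pi * t))))" for n
      using q(1) by (intro trig_approx_trig_poly trig_poly_real_polynomial_function)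
    show "(\<lambda>n. complex_of_real (q n (cis (2 * pi * t)))) \<longlonglongrightarrow> of_real (g (cis (2 * pi * t)))" for t
    proof (rule tendsto_of_real)
      have "(\<lambda>n. 1 / real (Suc n)) \<longlonglongrightarrow> 0" by real_asymp
      then have "(\<lambda>n. q n (cis (2 * pi * t)) - g (cis (2 * pi * t))) \<longlonglongrightarrow> 0"
        by (rule Lim_null_comparison[rotated])
           (use q(2)[OF cs] in \<open>auto simp: abs_minus_commute intro!: always_eventually less_imp_le\<close>)
      then show "(\<lambda>n. q n (cis (2 * pi * t))) \<longlonglongrightarrow> g (cis (2 * pi * t))"
        by (rule LIM_zero_cancel)
    qed
    show "norm (complex_of_real (q n (cis (2 * pi * t)))) \<le> C + 1" for n t
    proof -
      have "1 / real (Suc n) \<le> 1" by simp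
      then show ?thesis
        using q(2)[OF cs, of "2 * pi * t" n] C[OF cs, of "2 * pi * t"] unfolding norm_of_real by linarith
    qed
  qed simp_all
qed

text \<open>A Dynkin induction from the open sets, which are closed under intersection. For open U
  the continuous functions min 1 (n * dist(z, -U)) tend to the indicator; for a disjoint union the
  partial sums are again indicators, hence bounded by 1.\<close>

lemma trig_approx_indicator_circle:
  fixes A :: "complex set"
  assumes "A \<in> sets borel"
  shows "trig_approx (\<lambda>t. indicator A (cis (2 * pi * t)))"
proof -
  have [measurable]: "(\<lambda>t. cis (2 * pi * t)) \<in> borel_measurable borel"
    by (intro borel_measurable_continuous_onI continuous_intros)
  have "Int_stable {S::complex set. open S}"
    by (auto simp: Int_stable_def)
  moreover have "{S::complex set. open S} \<subseteq> Pow UNIV" by auto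
  moreover have "A \<in> sigma_sets UNIV {S. open S}"
    using assms by (simp add: borel_def)
  ultimately show ?thesis
  proof (induction rule: sigma_sets_induct_disjoint)
    case (basic U)
    define g where "g n z = min 1 (real n * infdist z (- U))" for n :: nat and z :: complex
    show ?case
    proof (cases "U = UNIV")
      \<comment> \<open>Here the complement is empty and \<open>infdist\<close> to the empty set is
        0 by convention, so the functions \<open>g n\<close> would all vanish.\<close>
      case True
      then show ?thesis by (simp add: trig_approx_trig_poly trig_poly_const)
    next
      case False
      have [measurable]: "U \<in> sets borel" using basic by simp
      show ?thesis
      proof (rule trig_approx_dominated)
        show "trig_approx (\<lambda>t. of_real (g n (cis (2 * pi * t))))" for n
          unfolding g_def by (intro trig_approx_continuous_circle continuous_intros)
        show "(\<lambda>n. complex_of_real (g n (cis (2 * pi * t)))) \<longlonglongrightarrow> indicator U (cis (2 * pi * t))" for t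
        proof -
          define z where "z = cis (2 * pi * t)"
          have "(\<lambda>n. g n z) \<longlonglongrightarrow> indicator U z"
          proof (cases "z \<in> U")
            case True
            then have "infdist z (- U) > 0"
              using False basic by (intro infdist_pos_not_in_closed) auto
            then have "(\<lambda>n. min 1 (real n * infdist z (- U))) \<longlonglongrightarrow> 1"
              by real_asymp
            then show ?thesis using True by (simp add: g_def)
          qed (simp add: g_def)
          then have "(\<lambda>n. complex_of_real (g n z)) \<longlonglongrightarrow> of_real (indicator U z)"
            by (rule tendsto_of_real)
          then show ?thesis by (cases "z \<in> U") (simp_all add: z_def)
        qed
        show "norm (complex_of_real (g n (cis (2 * pi * t)))) \<le> 1" for n t
          by (simp add: g_def infdist_nonneg)
      qed simp_all
    qed
  next
    case empty
    then show ?case by (simp add: trig_approx_trig_poly trig_poly_const)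
  next
    case (compl A)
    have "trig_approx (\<lambda>t. 1 + (-1) * indicator A (cis (2 * pi * t)))"
      by (intro trig_approx_add trig_approx_cmult compl trig_approx_trig_poly trig_poly_const)
    moreover have "(\<lambda>t. 1 + (-1) * indicator A (cis (2 * pi * t))) = 
       (\<lambda>t. indicator (UNIV - A) (cis (2 * pi * t)) :: complex)"
      by (auto simp: indicator_def)
    ultimately show ?case by simp
  next
    case (union A)
    have [measurable]: "A i \<in> sets borel" for i
      using union by (auto simp: borel_def)
    then have "(\<Union>i. A i) \<in> sets borel" by blast
    note this [measurable]
    show ?case
    proof (rule trig_approx_dominated)
      show "trig_approx (\<lambda>t. \<Sum>i<n. indicator (A i) (cis (2 * pi * t)))" for n
        by (intro trig_approx_sum union) auto
      have eq: "(\<Sum>i<n. indicator (A i) z :: complex) = indicator (\<Union>i<n. A i) z" for n z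
        using union(1) by (intro indicator_UN_disjoint[symmetric]) (auto intro: disjoint_family_on_mono)
      show "(\<lambda>n. \<Sum>i<n. indicator (A i) (cis (2 * pi * t)) :: complex) \<longlonglongrightarrow> indicator (\<Union>i. A i) (cis (2 * pi * t))" for t
        unfolding eq by (rule LIMSEQ_indicator_UN)
      show "norm (\<Sum>i<n. indicator (A i) (cis (2 * pi * t)) :: complex) \<le> 1" for n t
        unfolding eq by (simp add: indicator_def)
    qed simp_all
  qed
qed

lemma trig_approx_AE_cong:
  assumes "trig_approx f" and [measurable]: "g \<in> borel_measurable borel" 
    and AE: "AE t in unit_lebesgue. f t = g t"
  shows "trig_approx g"
proof -
  have [measurable]: "f \<in> borel_measurable borel"
    using assms by (auto simp: trig_approx_def L2_fun_def)
  have "integrable unit_lebesgue (\<lambda>t. (norm (f t))\<^sup>2) = integrable unit_lebesgue (\<lambda>t. (norm (g t))\<^sup>2)"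
    by (rule integrable_cong_AE) (use AE in auto)
  then have "L2_fun unit_lebesgue g"
    using assms(1) by (simp add: trig_approx_def L2_fun_def)
  moreover have "(LINT t|unit_lebesgue. (norm (g t - f t))\<^sup>2) = (LINT t|unit_lebesgue. 0)"
    by (rule integral_cong_AE) (use AE in auto)
  ultimately show ?thesis
    using assms(1) by (intro trig_approx_closed) auto
qed

text \<open>Up to points outside [0, 1), which carry no mass, \<open>A\<close> is the preimage of a
  Borel set of the circle, so the indicator is inherited from there.\<close>

lemma trig_approx_indicator:
  assumes [measurable]: "A \<in> sets borel"
  shows "trig_approx (indicator A)"
proof -
  \<comment> \<open>a Borel inverse of \<open>t \<mapsto> cis (2 * pi * t)\<close> on \<open>[0, 1)\<close>; the clamping makes the argument of
    \<open>arccos\<close> globally continuous\<close>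
  define \<psi> where "\<psi> z = (if Im z \<ge> 0 then arccos (max (-1) (min 1 (Re z))) 
     else 2 * pi - arccos (max (-1) (min 1 (Re z)))) / (2 * pi)" for z :: complex
  have [measurable]: "\<psi> \<in> borel_measurable borel"
  proof -
    have [measurable]: "(\<lambda>z::complex. arccos (max (-1) (min 1 (Re z)))) \<in> borel_measurable borel"
      by (intro borel_measurable_continuous_onI continuous_on_arccos continuous_intros) auto
    show ?thesis unfolding \<psi>_def by measurable
  qed
  have \<psi>: "\<psi> (cis (2 * pi * t)) = t" if "0 \<le> t" "t < 1" for t
  proof (cases "t \<le> 1 / 2")
    case True
    then have "0 \<le> 2 * pi * t" "2 * pi * t \<le> pi" using that by auto
    then show ?thesis 
      by (simp add: \<psi>_def sin_ge_zero arccos_cos)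
  next
    case False
    \<comment> \<open>The point lies in the open lower half plane, where \<open>arccos\<close>
      measures the angle clockwise and \<open>\<psi>\<close> subtracts it from 2 * pi.\<close>
    have "sin (2 * pi * t) < 0"
      using False that by (intro sin_lt_zero) auto
    moreover have "arccos (cos (2 * pi - 2 * pi * t)) = 2 * pi - 2 * pi * t"
    proof (rule arccos_cos)
      have "2 * pi * t \<le> 2 * pi * 1" using that by (intro mult_left_mono) auto
      then show "0 \<le> 2 * pi - 2 * pi * t" by simp
      have "pi * 1 \<le> pi * (2 * t)" using False by (intro mult_left_mono) auto
      then show "2 * pi - 2 * pi * t \<le> pi" by simp
    qed
    ultimately show ?thesis
      by (simp add: \<psi>_def cos_2pi_minus)
  qed
  have "\<psi> -` A \<inter> space borel \<in> sets borel" by measurable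
  then have "trig_approx (\<lambda>t. indicator (\<psi> -` A) (cis (2 * pi * t)))"
    by (intro trig_approx_indicator_circle) simp
  then show ?thesis
  proof (rule trig_approx_AE_cong)
    show "AE t in unit_lebesgue. indicator (\<psi> -` A) (cis (2 * pi * t)) = (indicator A t :: complex)"
      unfolding unit_lebesgue_def by (subst AE_density) (auto simp: \<psi> indicator_def)
  qed simp
qed

text \<open>Simple functions are finite combinations of indicators, and they can be chosen to
  converge pointwise to \<open>f\<close> with norm at most 2 |f|, a square-integrable
  majorant.\<close>

theorem trig_poly_dense_L2:
  assumes f: "L2_fun unit_lebesgue f"
  shows "trig_approx f"
proof -
  have [measurable]: "f \<in> borel_measurable unit_lebesgue" and i: "integrable unit_lebesgue (\<lambda>t. (norm (f t))\<^sup>2)"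
    using f by (auto simp: L2_fun_def)
  obtain s where s: "\<And>n. simple_function unit_lebesgue (s n)" "\<And>t. (\<lambda>n. s n t) \<longlonglongrightarrow> f t"
    "\<And>n t. dist (s n t) 0 \<le> 2 * dist (f t) 0"
    using borel_measurable_implies_sequence_metric[of f unit_lebesgue 0] by auto
  show ?thesis
  proof (rule trig_approx_dominated)
    show "trig_approx (s n)" for n
    proof -
      have fin: "finite (range (s n))" and m: "\<And>x. s n -` {x} \<in> sets borel"
        using simple_functionD[OF s(1), of n] by simp_all
      have "(\<Sum>y\<in>range (s n). y * indicator (s n -` {y}) t) = s n t" for t
      proof -
        have "(\<Sum>y\<in>range (s n). y * indicator (s n -` {y}) t) = (\<Sum>y\<in>range (s n). if y = s n t then y else 0)"
          by (intro sum.cong) (simp_all add: indicator_def)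
        then show ?thesis using fin by simp
      qed
      then have eq: "(\<lambda>t. \<Sum>y\<in>range (s n). y * indicator (s n -` {y}) t) = s n"
        by (rule ext)
      have "trig_approx (\<lambda>t. \<Sum>y\<in>range (s n). y * indicator (s n -` {y}) t)"
        using fin m by (intro trig_approx_sum trig_approx_cmult trig_approx_indicator)
      then show ?thesis unfolding eq .
    qed
    show "integrable unit_lebesgue (\<lambda>t. (2 * norm (f t))\<^sup>2)"
      using i by (simp add: power_mult_distrib)
    show "norm (s n t) \<le> 2 * norm (f t)" for n t
      using s(3)[of n t] by simp
    show "f \<in> borel_measurable borel"
      using f by (simp add: L2_fun_def)
  qed (rule s(2))
qed

lemma trig_poly_imp_sum:
  assumes "trig_poly p"
  shows "\<exists>F c. finite F \<and> p = (\<lambda>t. \<Sum>n\<in>F. c n * cis (2 * pi * of_int n * t))"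
  using assms
proof induction
  case (monom c n)
  show ?case by (rule exI[of _ "{n}"], rule exI[of _ "\<lambda>_. c"]) simp
next
  case (add p q)
  then obtain F c G d where "finite F" "finite G" 
    and p: "p = (\<lambda>t. \<Sum>n\<in>F. c n * cis (2 * pi * of_int n * t))"
    and q: "q = (\<lambda>t. \<Sum>n\<in>G. d n * cis (2 * pi * of_int n * t))" by blast
  let ?e = "\<lambda>n. (if n \<in> F then c n else 0) + (if n \<in> G then d n else 0)"
  have "p t + q t = (\<Sum>n\<in>F \<union> G. ?e n * cis (2 * pi * of_int n * t))" for t
  proof -
    have "p t = (\<Sum>n\<in>F \<union> G. (if n \<in> F then c n else 0) * cis (2 * pi * of_int n * t))"
      unfolding p using \<open>finite F\<close> \<open>finite G\<close> by (intro sum.mono_neutral_cong_left) auto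
    moreover have "q t = (\<Sum>n\<in>F \<union> G. (if n \<in> G then d n else 0) * cis (2 * pi * of_int n * t))"
      unfolding q using \<open>finite F\<close> \<open>finite G\<close> by (intro sum.mono_neutral_cong_left) auto
    ultimately show ?thesis by (simp add: sum.distrib distrib_right)
  qed
  then have "(\<lambda>t. p t + q t) = (\<lambda>t. \<Sum>n\<in>F \<union> G. ?e n * cis (2 * pi * of_int n * t))" by (rule ext)
  moreover have "finite (F \<union> G)" using \<open>finite F\<close> \<open>finite G\<close> by simp
  ultimately show ?case by (intro exI conjI)
qed

section \<open>Spectra of the segment\<close>

lemma expo_axis: "expo l (vector [t, 0]) = cis (2 * pi * (- (l $ 1)) * t)"
  by (simp add: expo_def cis_conv_exp inner_vec_def sum_2 mult_ac)

lemma norm_expo: "norm (expo l x) = 1"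
  by (simp add: expo_def norm_exp_eq_Re)

lemma continuous_on_expo [continuous_intros]:
  "continuous_on S f \<Longrightarrow> continuous_on S (\<lambda>x. expo l (f x))"
  unfolding expo_def by (intro continuous_intros)

lemma expo_measurable [measurable]: "expo l \<in> borel_measurable borel"
  by (intro borel_measurable_continuous_onI continuous_intros)

lemma integral_unit_lebesgue_cis:
  "(LINT t|unit_lebesgue. cis (2 * pi * d * t)) =
     (if d = 0 then 1 else (cis (2 * pi * d) - 1) / (2 * pi * \<i> * d))"
proof (cases "d = 0")
  case True
  interpret prob_space unit_lebesgue by (rule prob_space_unit_lebesgue)
  show ?thesis using True prob_space by simp
next
  case False
  have [measurable]: "(\<lambda>t. cis (2 * pi * d * t)) \<in> borel_measurable borel"
    by (intro borel_measurable_continuous_onI continuous_intros)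
  have unit: "unit_lebesgue = density lborel (\<lambda>t. ennreal (indicator {0..<1} t))"
    by (simp add: unit_lebesgue_def ennreal_indicator)
  define F where "F t = cis (2 * pi * d * t) / (2 * pi * \<i> * d)" for t
  have "has_bochner_integral lborel (\<lambda>t. indicator {0..1} t *\<^sub>R cis (2 * pi * d * t)) (F 1 - F 0)"
  proof (rule has_bochner_integral_FTC_Icc)
    show "(F has_vector_derivative cis (2 * pi * d * t)) (at t within {0..1})" for t
    proof -
      define w where "w = 2 * pi * \<i> * d"
      have "w \<noteq> 0" using False by (simp add: w_def)
      then have "((\<lambda>z. exp (z * w) / w) has_field_derivative exp (of_real t * w)) (at (of_real t))"
        by (auto intro!: derivative_eq_intros)
      then have "((\<lambda>t. exp (of_real t * w) / w) has_vector_derivative exp (of_real t * w)) (at t within {0..1})"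
        by (rule has_vector_derivative_real_field)
      moreover have "(\<lambda>t. exp (of_real t * w) / w) = F" "exp (of_real t * w) = cis (2 * pi * d * t)"
        by (simp_all add: fun_eq_iff F_def w_def cis_conv_exp mult_ac)
      ultimately show ?thesis by simp
    qed
  qed (auto intro!: continuous_intros)
  then have "(LINT t|lborel. indicator {0..1} t *\<^sub>R cis (2 * pi * d * t)) = F 1 - F 0"
    by (rule has_bochner_integral_integral_eq)
  \<comment> \<open>The fundamental theorem is applied on the closed interval; the extra endpoint 1
    is a null set.\<close>
  moreover have "(LINT t|lborel. indicator {0..1} t *\<^sub>R cis (2 * pi * d * t)) =
     (LINT t|lborel. indicator {0..<1} t *\<^sub>R cis (2 * pi * d * t))"
  proof (rule integral_cong_AE)
    show "AE t in lborel. indicator {0..1} t *\<^sub>R cis (2 * pi * d * t) = indicator {0..<1} t *\<^sub>R cis (2 * pi * d * t)"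
      using AE_lborel_singleton[of "1::real"] by eventually_elim (auto simp: indicator_def)
  qed measurable
  moreover have "(LINT t|unit_lebesgue. cis (2 * pi * d * t)) = 
    (LINT t|lborel. indicator {0..<1} t *\<^sub>R cis (2 * pi * d * t))"
    unfolding unit by (rule integral_density) auto
  ultimately show ?thesis
    using False by (simp add: F_def diff_divide_distrib)
qed

text \<open>The source of all orthogonality: one direction forces integer gaps in a spectrum, the
  other makes the constructed families orthogonal.\<close>

lemma integral_unit_lebesgue_cis_eq_0_iff:
  "(LINT t|unit_lebesgue. cis (2 * pi * d * t)) = 0 \<longleftrightarrow> d \<in> \<int> - {0}"
proof -
  have "cis (2 * pi * d) = 1 \<longleftrightarrow> d \<in> \<int>"
  proof
    assume "cis (2 * pi * d) = 1"
    then have "cos (2 * pi * d) = 1" by (simp add: complex_eq_iff)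
    then show "d \<in> \<int>" by (auto simp: cos_one_2pi_int)
  next
    assume "d \<in> \<int>"
    then show "cis (2 * pi * d) = 1" by (auto simp: complex_eq_iff elim!: Ints_cases)
  qed
  then show ?thesis by (simp add: integral_unit_lebesgue_cis)
qed

lemma L2_inner_expo_segment:
  "L2_inner segment_measure (expo a) (expo b) = (LINT t|unit_lebesgue. cis (2 * pi * (b $ 1 - a $ 1) * t))"
proof -
  have "L2_inner segment_measure (expo a) (expo b) = 
     (LINT t|unit_lebesgue. expo a (vector [t, 0]) * cnj (expo b (vector [t, 0])))"
    unfolding L2_inner_def segment_measure_def
    by (rule integral_distr) (auto intro!: borel_measurable_continuous_onI continuous_intros)
  also have "\<dots> = (LINT t|unit_lebesgue. cis (2 * pi * (b $ 1 - a $ 1) * t))"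
    by (simp add: expo_axis cis_mult cis_cnj algebra_simps)
  finally show ?thesis .
qed

lemma L2_fun_expo_segment: "L2_fun segment_measure (expo l)"
proof -
  interpret prob_space segment_measure by (rule prob_space_segment_measure)
  show ?thesis
    by (rule L2_fun_bounded[where C = 1]) (auto simp: norm_expo)
qed

lemma spectrum_segment_diff_Ints:
  assumes "is_spectrum segment_measure \<Lambda>" "a \<in> \<Lambda>" "b \<in> \<Lambda>" "a \<noteq> b"
  shows "b $ 1 - a $ 1 \<in> \<int> - {0}"
  using assms unfolding is_spectrum_def orthonormal_basis_L2_def L2_inner_expo_segment
    integral_unit_lebesgue_cis_eq_0_iff[symmetric] by auto

text \<open>Discreteness and orthogonality come from the integer gaps between first coordinates. For
  completeness, a trigonometric polynomial close to f on the axis is carried to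
  \<open>\<Lambda>\<close> by inverting the projection.\<close>

lemma is_spectrum_segmentI:
  assumes inj: "inj_on (\<lambda>x. x $ 1) \<Lambda>" and img: "(\<lambda>x. x $ 1) ` \<Lambda> = \<int>"
  shows "is_spectrum segment_measure \<Lambda>"
proof -
  have diff: "b $ 1 - a $ 1 \<in> \<int> - {0}" if "a \<in> \<Lambda>" "b \<in> \<Lambda>" "a \<noteq> b" for a b
  proof -
    have "a $ 1 \<in> \<int>" "b $ 1 \<in> \<int>" using img that by auto
    moreover have "a $ 1 \<noteq> b $ 1" using inj that by (auto dest: inj_onD)
    ultimately show ?thesis by simp
  qed
  have "uniform_discrete \<Lambda>"
  proof (rule uniformI1[of 1])
    fix a b assume ab: "a \<in> \<Lambda>" "b \<in> \<Lambda>" "dist a b < 1"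
    show "a = b"
    proof (rule ccontr)
      assume "a \<noteq> b"
      then obtain k where "b $ 1 - a $ 1 = of_int k" "k \<noteq> 0"
        using diff[OF ab(1,2)] by (auto elim!: Ints_cases)
      then have "1 \<le> dist (a $ 1) (b $ 1)" 
        by (simp add: dist_real_def abs_minus_commute)
      then show False using dist_vec_nth_le[of a 1 b] ab(3) by linarith
    qed
  qed simp
  then have "discrete \<Lambda>" by (rule uniform_discrete_imp_discrete)
  moreover have "orthonormal_basis_L2 segment_measure expo \<Lambda>"
    unfolding orthonormal_basis_L2_def
  proof (intro conjI ballI allI impI)
    show "L2_fun segment_measure (expo l)" for l by (rule L2_fun_expo_segment)
    show "L2_inner segment_measure (expo a) (expo b) = (if a = b then 1 else 0)" if "a \<in> \<Lambda>" "b \<in> \<Lambda>" for a b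
    proof (cases "a = b")
      case True
      then show ?thesis
        using integral_unit_lebesgue_cis[of 0] by (simp only: L2_inner_expo_segment diff_self of_real_0) simp
    next
      case False
      then show ?thesis
        using diff[OF that False] by (simp only: L2_inner_expo_segment integral_unit_lebesgue_cis_eq_0_iff if_False)
    qed
  next
    fix f :: "real^2 \<Rightarrow> complex" and \<epsilon> :: real
    assume f: "L2_fun segment_measure f" and "\<epsilon> > 0"
    have [measurable]: "f \<in> borel_measurable borel"
      using f by (simp add: L2_fun_def)
    have "integrable unit_lebesgue (\<lambda>t. (norm (f (vector [t, 0])))\<^sup>2)"
      using f unfolding L2_fun_def segment_measure_def by (subst (asm) integrable_distr_eq) auto
    then have "L2_fun unit_lebesgue (\<lambda>t. f (vector [t, 0]))"
      by (simp add: L2_fun_def)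
    then have "trig_approx (\<lambda>t. f (vector [t, 0]))"
      by (rule trig_poly_dense_L2)
    then obtain p where p: "trig_poly p" 
      "(LINT t|unit_lebesgue. (norm (f (vector [t, 0]) - p t))\<^sup>2) < \<epsilon>"
      using \<open>\<epsilon> > 0\<close> unfolding trig_approx_def by blast
    obtain F c where F: "finite F" and pF: "p = (\<lambda>t. \<Sum>n\<in>F. c n * cis (2 * pi * of_int n * t))"
      using trig_poly_imp_sum[OF p(1)] by blast
    \<comment> \<open>\<open>expo\<close> has a minus sign in its exponent, so frequency n belongs
      to the point with first coordinate -n.\<close>
    define l where "l n = inv_into \<Lambda> (\<lambda>x. x $ 1) (- of_int n)" for n :: int
    have l: "l n \<in> \<Lambda>" "l n $ 1 = - of_int n" for n
    proof -
      have "- of_int n \<in> (\<lambda>x. x $ 1) ` \<Lambda>" unfolding img by simp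
      then show "l n \<in> \<Lambda>" "l n $ 1 = - of_int n"
        unfolding l_def by (rule inv_into_into, rule f_inv_into_f)
    qed
    have inj_l: "inj_on l F"
    proof (rule inj_onI)
      fix m n assume "l m = l n"
      then have "l m $ 1 = l n $ 1" by simp
      then show "m = n" by (simp add: l)
    qed
    \<comment> \<open>At x = \<open>l n\<close> the floor is exact and only converts the real number
      n back to an integer.\<close>
    define d where "d x = c (\<lfloor>- (x $ 1)\<rfloor>)" for x :: "real^2"
    define q where "q x = (\<Sum>i\<in>l ` F. d i * expo i x)" for x
    have q: "q (vector [t, 0]) = p t" for t
      unfolding q_def pF by (subst sum.reindex[OF inj_l]) (simp add: d_def l expo_axis)
    have [measurable]: "q \<in> borel_measurable borel" unfolding q_def by measurable
    have "(LINT x|segment_measure. (norm (f x - q x))\<^sup>2) = 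
      (LINT t|unit_lebesgue. (norm (f (vector [t, 0]) - q (vector [t, 0])))\<^sup>2)"
      unfolding segment_measure_def by (rule integral_distr) auto
    then have "(LINT x|segment_measure. (norm (f x - q x))\<^sup>2) < \<epsilon>"
      using p(2) by (simp add: q)
    then show "\<exists>F c. finite F \<and> F \<subseteq> \<Lambda> \<and>
      (LINT x|segment_measure. (norm (f x - (\<Sum>i\<in>F. c i * expo i x)))\<^sup>2) < \<epsilon>"
      using F l(1) unfolding q_def by (intro exI[of _ "l ` F"] exI[of _ d]) auto
  qed
  ultimately show ?thesis by (simp add: is_spectrum_def)
qed

section \<open>Beurling dimensions\<close>

lemma beurling_dim_nonneg: "0 \<le> beurling_dim \<Lambda>"
  unfolding beurling_dim_def by (rule Inf_greatest) auto

text \<open>Such a count makes the density at r finite, not necessarily zero. It does vanish at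
  every s > r, and s may be taken arbitrarily close to r.\<close>

lemma beurling_dim_le:
  assumes "0 \<le> r"
    and count: "\<And>x h. 1 \<le> h \<Longrightarrow> finite (\<Lambda> \<inter> ball x h) \<and> real (card (\<Lambda> \<inter> ball x h)) \<le> C * h powr r"
  shows "beurling_dim \<Lambda> \<le> ereal r"
proof -
  have "upper_beurling_density r \<Lambda> \<le> ennreal C"
    unfolding upper_beurling_density_def
  proof (rule Limsup_bounded)
    show "\<forall>\<^sub>F h in at_top. (SUP x. emeasure (count_space UNIV) (\<Lambda> \<inter> ball x h) / ennreal (h powr r)) \<le> ennreal C"
      using eventually_ge_at_top[of "1::real"]
    proof eventually_elim
      case (elim h)
      show ?case
      proof (rule SUP_least)
        fix x
        have pos: "h powr r > 0" using elim by simp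
        have "emeasure (count_space UNIV) (\<Lambda> \<inter> ball x h) / ennreal (h powr r) 
          = ennreal (real (card (\<Lambda> \<inter> ball x h)) / h powr r)"
          using count[OF elim, of x] pos
          by (simp add: emeasure_count_space_finite divide_ennreal ennreal_of_nat_eq_real_of_nat)
        also have "\<dots> \<le> ennreal C"
          using count[OF elim, of x] pos by (intro ennreal_leI) (simp add: field_simps)
        finally show "emeasure (count_space UNIV) (\<Lambda> \<inter> ball x h) / ennreal (h powr r) \<le> ennreal C" .
      qed
    qed
  qed
  then have fin: "upper_beurling_density r \<Lambda> \<noteq> \<infinity>"
    by (auto simp: top_unique)
  show ?thesis
  proof (rule dense_ge)
    fix y assume "ereal r < y"
    then obtain s where s: "ereal r < ereal s" "ereal s < y"
      using ereal_dense2 by blast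
    then have "beurling_dim \<Lambda> \<le> ereal s"
      unfolding beurling_dim_def using upper_beurling_density_eq_0[OF fin, of s] assms(1)
      by (intro Inf_lower) auto
    then show "beurling_dim \<Lambda> \<le> y" using s by auto
  qed
qed

lemma beurling_dim_spectrum_segment_le:
  assumes "is_spectrum segment_measure \<Lambda>"
  shows "beurling_dim \<Lambda> \<le> 1"
proof -
  have "beurling_dim \<Lambda> \<le> ereal 1"
  \<comment> \<open>The window for the floors contains at most 2 * h + 2 integers, which is at most
    4 * h for h \<ge> 1.\<close>
  proof (rule beurling_dim_le[where C = 4])
    fix x :: "real^2" and h :: real assume h: "1 \<le> h"
    let ?S = "\<Lambda> \<inter> ball x h"
    let ?J = "{\<lfloor>x $ 1 - h\<rfloor>..\<lfloor>x $ 1 + h\<rfloor>}"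
    \<comment> \<open>First coordinates need not be integers themselves, but shifting by a nonzero
      integer shifts the floor by the same amount.\<close>
    have inj: "inj_on (\<lambda>l. \<lfloor>l $ 1\<rfloor>) ?S"
    proof (rule inj_onI, rule ccontr)
      fix a b assume ab: "a \<in> ?S" "b \<in> ?S" "\<lfloor>a $ 1\<rfloor> = \<lfloor>b $ 1\<rfloor>" "a \<noteq> b"
      then obtain k where "b $ 1 - a $ 1 = of_int k" "k \<noteq> 0"
        using spectrum_segment_diff_Ints[OF assms, of a b] by (auto elim!: Ints_cases)
      then have "b $ 1 = a $ 1 + of_int k" by simp
      then show False using ab(3) \<open>k \<noteq> 0\<close> by simp
    qed
    have sub: "(\<lambda>l. \<lfloor>l $ 1\<rfloor>) ` ?S \<subseteq> ?J"
    proof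
      fix j assume "j \<in> (\<lambda>l. \<lfloor>l $ 1\<rfloor>) ` ?S"
      then obtain l where l: "dist x l < h" "j = \<lfloor>l $ 1\<rfloor>" by auto
      have "\<bar>x $ 1 - l $ 1\<bar> < h"
        using dist_vec_nth_le[of x 1 l] l(1) by (simp add: dist_real_def)
      then show "j \<in> ?J" using l(2) by (auto intro!: floor_mono)
    qed
    have "finite ?S" using inj sub by (meson finite_atLeastAtMost_int inj_on_finite)
    moreover have "card ?S \<le> card ?J"
      using inj sub by (intro card_inj_on_le) auto
    moreover have "real (card ?J) \<le> 4 * h"
    proof -
      have "\<lfloor>x $ 1 - h\<rfloor> \<le> \<lfloor>x $ 1 + h\<rfloor>" using h by (intro floor_mono) simp
      then have "real (card ?J) = of_int \<lfloor>x $ 1 + h\<rfloor> - of_int \<lfloor>x $ 1 - h\<rfloor> + 1"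
        by simp
      then show ?thesis using h by linarith
    qed
    ultimately show "finite ?S \<and> real (card ?S) \<le> 4 * h powr 1"
      using h by simp
  qed simp
  then show ?thesis by (simp add: one_ereal_def)
qed

section \<open>A spectrum of dimension 1\<close>

definition integer_axis :: "(real^2) set" where
  "integer_axis = range (\<lambda>n::int. vector [of_int n, 0])"

lemma is_spectrum_integer_axis: "is_spectrum segment_measure integer_axis"
  by (rule is_spectrum_segmentI)
    (auto simp: integer_axis_def inj_on_def image_image Ints_def)

text \<open>For r < 1 and h \<ge> 1 the ball around 0 alone contains at least h \<ge> h^r points, so
  the density at r is at least 1.\<close>

lemma beurling_dim_integer_axis_ge: "1 \<le> beurling_dim integer_axis"
  unfolding beurling_dim_def
proof (rule Inf_greatest, safe)
  fix r :: real assume "r > 0" and zero: "upper_beurling_density r integer_axis = 0"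
  have "\<not> r < 1"
  proof
    assume "r < 1"
    have "1 \<le> upper_beurling_density r integer_axis"
      unfolding upper_beurling_density_def
    proof (rule le_Limsup)
      show "\<forall>\<^sub>F h in at_top. 1 \<le> (SUP x. emeasure (count_space UNIV) (integer_axis \<inter> ball x h) / ennreal (h powr r))"
        using eventually_ge_at_top[of "1::real"]
      proof eventually_elim
        case (elim h)
        let ?S = "(\<lambda>n. vector [of_int n, 0] :: real^2) ` {0..<\<lceil>h\<rceil>}"
        have pos: "h powr r > 0" using elim by simp
        have sub: "?S \<subseteq> integer_axis \<inter> ball 0 h"
        proof
          fix y assume "y \<in> ?S"
          then obtain n where n: "0 \<le> n" "n < \<lceil>h\<rceil>" "y = vector [of_int n, 0]" by auto
          have "y = of_int n *\<^sub>R axis 1 1"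
            by (simp add: n(3) vec_eq_iff forall_2 axis_def)
          then have "norm y = of_int n"
            using n(1) by (simp add: norm_axis_1)
          then show "y \<in> integer_axis \<inter> ball 0 h"
            using n by (auto simp: integer_axis_def less_ceiling_iff)
        qed
        have "inj_on (\<lambda>n. vector [of_int n, 0] :: real^2) {0..<\<lceil>h\<rceil>}"
          by (auto simp: inj_on_def vec_eq_iff forall_2)
        then have card: "card ?S = nat \<lceil>h\<rceil>" by (simp add: card_image)
        have "h powr r \<le> h powr 1" using elim \<open>r < 1\<close> by (intro powr_mono) auto
        also have "h powr 1 \<le> real (card ?S)" using elim unfolding card by simp
        finally have "1 \<le> ennreal (real (card ?S) / h powr r)"
          using pos by simp
        also have "\<dots> = emeasure (count_space UNIV) ?S / ennreal (h powr r)"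
          using pos by (simp add: emeasure_count_space_finite divide_ennreal ennreal_of_nat_eq_real_of_nat)
        also have "\<dots> \<le> emeasure (count_space UNIV) (integer_axis \<inter> ball 0 h) / ennreal (h powr r)"
          using sub by (intro divide_right_mono_ennreal emeasure_mono) auto
        also have "\<dots> \<le> (SUP x. emeasure (count_space UNIV) (integer_axis \<inter> ball x h) / ennreal (h powr r))"
          by (rule SUP_upper) simp
        finally show ?case .
      qed
    qed simp
    then show False using zero by simp
  qed
  then show "1 \<le> ereal r" by (simp add: one_ereal_def)
qed

section \<open>A spectrum of dimension 0\<close>

text \<open>\<open>int_decode\<close> enumerates the integers by naturals, so every integer,
  negative ones included, receives its own power of two as height.\<close>

definition lacunary_lift :: "(real^2) set" where
  "lacunary_lift = range (\<lambda>k. vector [of_int (int_decode k), 2 ^ k])"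

lemma is_spectrum_lacunary_lift: "is_spectrum segment_measure lacunary_lift"
proof (rule is_spectrum_segmentI)
  show "inj_on (\<lambda>x. x $ 1) lacunary_lift"
    by (auto simp: lacunary_lift_def inj_on_def dest: injD[OF inj_int_decode])
  have "(\<lambda>x. x $ 1) ` lacunary_lift = of_int ` range int_decode"
    by (auto simp: lacunary_lift_def image_image)
  then show "(\<lambda>x. x $ 1) ` lacunary_lift = \<int>"
    by (simp add: surj_int_decode Ints_def)
qed

text \<open>The least index in the ball has to be set apart: the center is arbitrary, so even a
  small ball can meet a point of huge index. Every further index is below log 2 (4 * h).\<close>

lemma card_lacunary_lift_ball:
  assumes h: "1 \<le> h"
  shows "finite (lacunary_lift \<inter> ball x h)" 
    and "real (card (lacunary_lift \<inter> ball x h)) \<le> log 2 h + 4"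
proof -
  define g :: "nat \<Rightarrow> real^2" where "g k = vector [of_int (int_decode k), 2 ^ k]" for k
  define K where "K = {k. g k \<in> ball x h}"
  define m where "m = nat \<lceil>log 2 (4 * h)\<rceil>"
  have eq: "lacunary_lift \<inter> ball x h = g ` K"
    by (auto simp: lacunary_lift_def g_def K_def)
  \<comment> \<open>a member \<open>l\<close> of \<open>K\<close> that is not the least one satisfies \<open>2 ^ (l - 1) \<le> 2 ^ l - 2 ^ k < 2 * h\<close>\<close>
  have K: "K \<subseteq> insert (LEAST k. k \<in> K) {..<m}"
  proof
    fix l assume l: "l \<in> K"
    define k where "k = (LEAST k. k \<in> K)"
    have k: "k \<in> K" "k \<le> l" unfolding k_def using l by (rule LeastI, rule Least_le)
    show "l \<in> insert (LEAST k. k \<in> K) {..<m}"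
    proof (cases "k = l")
      case False
      then obtain j where j: "l = Suc j" "k \<le> j" using k(2) by (cases l) auto
      have "\<bar>x $ 2 - 2 ^ i\<bar> < h" if "i \<in> K" for i
      proof -
        have "dist (x $ 2) (g i $ 2) \<le> dist x (g i)" by (rule dist_vec_nth_le)
        also have "\<dots> < h" using that by (simp add: K_def)
        finally show ?thesis by (simp add: g_def dist_real_def)
      qed
      then have "\<bar>x $ 2 - 2 ^ k\<bar> < h" "\<bar>x $ 2 - 2 ^ l\<bar> < h"
        using k(1) l by blast+
      then have "2 ^ l - 2 ^ k < 2 * h" by linarith
      moreover have "(2::real) ^ k \<le> 2 ^ j" using j by simp
      moreover have "(2::real) ^ l = 2 * 2 ^ j" using j(1) by simp
      ultimately have "2 ^ l < 4 * h" by linarith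
      then have "real l < log 2 (4 * h)" using h by (simp add: less_log_iff powr_realpow)
      then show ?thesis by (simp add: m_def) linarith
    qed (simp add: k_def)
  qed
  then have "finite K" by (rule finite_subset) simp
  then show "finite (lacunary_lift \<inter> ball x h)" by (simp add: eq)
  have "card (g ` K) \<le> card K" using \<open>finite K\<close> by (rule card_image_le)
  also have "\<dots> \<le> card (insert (LEAST k. k \<in> K) {..<m})"
    using K by (intro card_mono) auto
  also have "\<dots> \<le> Suc m" by (metis card_insert_le_m1 card_lessThan diff_Suc_1 finite_lessThan le_refl zero_less_Suc)
  finally have "real (card (g ` K)) \<le> real m + 1" by simp
  \<comment> \<open>One unit pays for the ceiling in \<open>m\<close>, the other for the least
    index; the factor 4 under the logarithm gives two more.\<close>
  also have "\<dots> \<le> log 2 (4 * h) + 2"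
  proof -
    have "0 \<le> log 2 (4 * h)" using h by simp
    then show ?thesis unfolding m_def by linarith
  qed
  also have "log 2 (4 * h) = log 2 h + 2"
    using h log_pow_cancel[of "2::real" 2] by (simp add: log_mult)
  finally show "real (card (lacunary_lift \<inter> ball x h)) \<le> log 2 h + 4"
    by (simp add: eq)
qed

lemma beurling_dim_lacunary_lift: "beurling_dim lacunary_lift = 0"
proof (rule antisym)
  have le: "beurling_dim lacunary_lift \<le> ereal r" if "r > 0" for r
  \<comment> \<open>The constant adds the bounds 4 \<le> 4 * h^r and log 2 h \<le> h^r / (r * ln 2),
    the latter from ln h \<le> h^r / r.\<close>
  proof (rule beurling_dim_le[where C = "4 + 1 / (r * ln 2)"])
    fix x :: "real^2" and h :: real assume h: "1 \<le> h"
    have "log 2 h + 4 \<le> h powr r / r / ln 2 + 4 * h powr r"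
    proof (rule add_mono)
      show "log 2 h \<le> h powr r / r / ln 2"
        unfolding log_def using ln_powr_bound[OF h that] by (intro divide_right_mono) auto
      show "4 \<le> 4 * h powr r" using h that by (simp add: ge_one_powr_ge_zero)
    qed
    also have "\<dots> = (4 + 1 / (r * ln 2)) * h powr r" by (simp add: algebra_simps)
    finally show "finite (lacunary_lift \<inter> ball x h) \<and> 
      real (card (lacunary_lift \<inter> ball x h)) \<le> (4 + 1 / (r * ln 2)) * h powr r"
      using card_lacunary_lift_ball[OF h, of x] by linarith
  qed (use that in simp)
  show "beurling_dim lacunary_lift \<le> 0"
  proof (rule dense_ge)
    fix y :: ereal assume "0 < y"
    then obtain r where "0 < ereal r" "ereal r < y"
      using ereal_dense2 by blast
    then show "beurling_dim lacunary_lift \<le> y"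
      using le[of r] by auto
  qed
qed (rule beurling_dim_nonneg)

theorem theorem1p2:
  fixes R :: "real^2^2" and B :: "(real^2) set"
  assumes "R = vector [vector [2, 1], vector [0, 2]]"
    and "B = {vector [0, 0], vector [1, 0]}"
  shows "(\<forall>\<Lambda>. is_spectrum (self_affine_measure R B) \<Lambda> \<longrightarrow>
            0 \<le> beurling_dim \<Lambda> \<and> beurling_dim \<Lambda> \<le> 1) \<and>
         (\<exists>\<Lambda>. is_spectrum (self_affine_measure R B) \<Lambda> \<and> beurling_dim \<Lambda> = 0) \<and>
         (\<exists>\<Lambda>. is_spectrum (self_affine_measure R B) \<Lambda> \<and> beurling_dim \<Lambda> = 1)"
proof -
  have "beurling_dim integer_axis = 1"
    using beurling_dim_spectrum_segment_le[OF is_spectrum_integer_axis] beurling_dim_integer_axis_ge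
    by (rule antisym)
  then show ?thesis
    unfolding assms self_affine_measure_shear
    by (intro conjI allI impI exI[of _ lacunary_lift] exI[of _ integer_axis]
        beurling_dim_nonneg beurling_dim_spectrum_segment_le is_spectrum_integer_axis
        is_spectrum_lacunary_lift beurling_dim_lacunary_lift)
qed

end
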